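(* Let $\mathbf{m}=(m_1,\dots,m_n)$ be a list of positive integers which is coarsely symmetric, i.e. for every $i$ such that $m_i>1$ and for all $j$, $m_{i+j}=m_{i-j}$ (indices taken mod $n$). Then there exists a real locus configuration $\mathcal{A}_{\mathbf{m}}$ in $\mathbb{C}^2$ with cyclically ordered multiplicities $\mathbf{m}$, and it is unique up to rotation.
   Context: $\langle\cdot,\cdot\rangle$ denotes the standard $\mathbb{C}$-bilinear inner product on $\mathbb{C}^2$. An arrangement $\mathcal{A}$ in $\mathbb{C}^2$ is a finite collection of distinct lines $H_1,\dots,H_n$ through the origin, with positive integer multiplicities $m_1,\dots,m_n$; for each $i$ a normal vector $\alpha_i$ is chosen, $H_i=\{x:\langle\alpha_i,x\rangle=0\}$, and it is assumed that $\langle\alpha_i,\alpha_i\rangle\neq0$. Locus configuration: $\mathcal{A}$ is a locus configuration if for every $i$ and every integer $k\in\{1,\dots,m_i\}$ the $k$th locus equation at $H_i$ holds: $$\sum_{j\neq i}\frac{m_j(m_j+1)\langle\alpha_j,\alpha_j\rangle\langle\alpha_j,\alpha_i\rangle^{2k-1}}{\langle\alpha_j,x\rangle^{2k+1}}=0$$ for all $x\in H_i$ at which the expression is defined (i.e. $x\notin H_j$ for $j\neq i$). This does not depend on the choice of the $\alpha_i$. Real: $\mathcal{A}$ is real if all $\alpha_i$ may be chosen with real coordinates. Then for each $i$ there is a unique $\theta_i\in\mathbb{R}/2\pi\mathbb{Z}$ such that $\alpha_i$ is a multiple of $(\cos(\theta_i/2),\sin(\theta_i/2))$. Cyclically ordered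 multiplicities: a real arrangement has cyclically ordered multiplicities $\mathbf{m}=(m_1,\dots,m_n)$ if its $n$ lines can be labelled $H_1,\dots,H_n$ so that $H_i$ has multiplicity $m_i$ and $(\theta_1,\dots,\theta_n)$ is cyclically ordered, meaning that, with representatives of the $\theta_i$ in $[0,2\pi)$, there is some $i$ with $\theta_i<\theta_{i+1}<\dots<\theta_n<\theta_1<\dots<\theta_{i-1}$. Unique up to rotation: any two such arrangements are carried to each other (lines with multiplicities) by a rotation of $\mathbb{R}^2$, extended to $\mathbb{C}^2$; equivalently, a simultaneous translation of all $\theta_i$ in $\mathbb{R}/2\pi\mathbb{Z}$. *)

theory Defs
  imports "HOL-Analysis.Analysis"
begin

definition hyp :: "complex^2 \<Rightarrow> (complex^2) set" where
  "hyp \<alpha> = {x. scalar_product \<alpha> x = 0}"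

(* Values of mult outside lines are irrelevant junk. *)
record line_arr =
  lines :: "(complex^2) set set"
  mult :: "(complex^2) set \<Rightarrow> nat"

definition normals :: "line_arr \<Rightarrow> ((complex^2) set \<Rightarrow> complex^2) \<Rightarrow> bool" where
  "normals A \<alpha> \<longleftrightarrow> (\<forall>H\<in>lines A. H = hyp (\<alpha> H) \<and> scalar_product (\<alpha> H) (\<alpha> H) \<noteq> 0)"

definition arrangement :: "line_arr \<Rightarrow> bool" where
  "arrangement A \<longleftrightarrow>
     finite (lines A) \<and> (\<forall>H\<in>lines A. 0 < mult A H) \<and> (\<exists>\<alpha>. normals A \<alpha>)"

definition locus_equation ::
  "line_arr \<Rightarrow> ((complex^2) set \<Rightarrow> complex^2) \<Rightarrow> (complex^2) set \<Rightarrow> nat \<Rightarrow> bool" where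
  "locus_equation A \<alpha> H k \<longleftrightarrow>
     (\<forall>x\<in>H. (\<forall>K\<in>lines A - {H}. x \<notin> K) \<longrightarrow>
       (\<Sum>K\<in>lines A - {H}.
          of_nat (mult A K * (mult A K + 1)) * scalar_product (\<alpha> K) (\<alpha> K)
            * scalar_product (\<alpha> K) (\<alpha> H) ^ (2 * k - 1)
            / scalar_product (\<alpha> K) x ^ (2 * k + 1)) = 0)"

(* Rescaling normals rescales each equation by a nonzero factor, so the choice of
   normals in the following definition is immaterial. *)
definition locus_configuration :: "line_arr \<Rightarrow> bool" where
  "locus_configuration A \<longleftrightarrow> arrangement A \<and>
     (\<exists>\<alpha>. normals A \<alpha> \<and> (\<forall>H\<in>lines A. \<forall>k\<in>{1..mult A H}. locus_equation A \<alpha> H k))"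

definition real_normals :: "line_arr \<Rightarrow> ((complex^2) set \<Rightarrow> complex^2) \<Rightarrow> bool" where
  "real_normals A \<alpha> \<longleftrightarrow> normals A \<alpha> \<and> (\<forall>H\<in>lines A. \<forall>i. \<alpha> H $ i \<in> \<real>)"

definition real_arr :: "line_arr \<Rightarrow> bool" where
  "real_arr A \<longleftrightarrow> (\<exists>\<alpha>. real_normals A \<alpha>)"

(* A class in R / 2 pi Z is given by its representative t in [0, 2 pi). For a nonzero
   vector with real coordinates exactly one such t exists: t and t + 2 pi yield
   opposite direction vectors. *)
definition has_angle :: "complex^2 \<Rightarrow> real \<Rightarrow> bool" where
  "has_angle \<alpha> t \<longleftrightarrow> 0 \<le> t \<and> t < 2 * pi \<and>
     (\<exists>c::complex. \<alpha> = c *s vector [complex_of_real (cos (t / 2)), complex_of_real (sin (t / 2))])"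

definition cyclically_ordered :: "real list \<Rightarrow> bool" where
  "cyclically_ordered ts \<longleftrightarrow> (\<exists>k. sorted_wrt (<) (rotate k ts))"

definition has_cyc_mults :: "line_arr \<Rightarrow> nat list \<Rightarrow> bool" where
  "has_cyc_mults A m \<longleftrightarrow>
     (\<exists>Hs \<alpha> \<theta>. distinct Hs \<and> set Hs = lines A \<and> map (mult A) Hs = m \<and>
        real_normals A \<alpha> \<and> (\<forall>H\<in>lines A. has_angle (\<alpha> H) (\<theta> H)) \<and>
        cyclically_ordered (map \<theta> Hs))"

(* Indices start at 0; differences of indices are formed in int before reducing mod n. *)
definition coarsely_symmetric :: "nat list \<Rightarrow> bool" where
  "coarsely_symmetric m \<longleftrightarrow>
     (\<forall>i<length m. 1 < m ! i \<longrightarrow>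
        (\<forall>j::int. m ! nat ((int i + j) mod int (length m))
                = m ! nat ((int i - j) mod int (length m))))"

definition carries :: "real^2^2 \<Rightarrow> line_arr \<Rightarrow> line_arr \<Rightarrow> bool" where
  "carries Q A B \<longleftrightarrow>
     (let f = (\<lambda>H. (\<lambda>x. map_matrix complex_of_real Q *v x) ` H)
      in lines B = f ` lines A \<and> (\<forall>H\<in>lines A. mult B (f H) = mult A H))"

end

theory Submission
  imports Defs
begin

text \<open>
  For unit normals at the angles \<open>\<phi>\<^sub>i = \<theta>\<^sub>i / 2\<close>, the \<open>k\<close>th locus equation at \<open>H\<^sub>i\<close> says that the sum of
  \<open>m\<^sub>j (m\<^sub>j + 1) cos (\<phi>\<^sub>j - \<phi>\<^sub>i) ^ (2k - 1) / sin (\<phi>\<^sub>j - \<phi>\<^sub>i) ^ (2k + 1)\<close> over \<open>j \<noteq> i\<close> vanishes.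
  For \<open>k = 1\<close> these are the equations for an equilibrium of particles on a circle whose pair
  potential is a multiple of \<open>1 / sin (\<phi>\<^sub>i - \<phi>\<^sub>j)\<^sup>2\<close>. A minimum of the energy exists because the potential
  blows up at collisions, and an equilibrium with prescribed cyclic order is unique up to
  translation because the force is strictly monotone in the distance. If \<open>m\<^sub>i > 1\<close>, then
  reflecting the equilibrium in \<open>H\<^sub>i\<close> gives an equilibrium with the same multiplicities, so it is
  symmetric about \<open>H\<^sub>i\<close>; the summands being odd, the equations at \<open>H\<^sub>i\<close> then hold for all \<open>k\<close>.
\<close>

subsection \<open>Equilibria: uniqueness and symmetry\<close>

definition locus_term :: "nat \<Rightarrow> real \<Rightarrow> real" where
  "locus_term k x = cos x ^ (2 * k - 1) / sin x ^ (2 * k + 1)"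

lemma locus_term_minus: "1 \<le> k \<Longrightarrow> locus_term k (- x) = - locus_term k x"
  by (simp add: locus_term_def)

text \<open>Division by zero gives 0, so sums over all particles may include the self-interaction
  term.\<close>

lemma locus_term_0 [simp]: "locus_term k 0 = 0"
  by (simp add: locus_term_def)

lemma locus_term_shift: "1 \<le> k \<Longrightarrow> locus_term k (x + pi) = locus_term k x"
  by (simp add: locus_term_def)

text \<open>Since 1 / sin^2 = 1 + cot^2, the force is cot + cot^3, an increasing polynomial in the
  strictly decreasing cotangent.\<close>

lemma locus_term_1_strict_antimono:
  assumes "0 < x" "x < y" "y < pi"
  shows "locus_term 1 y < locus_term 1 x"
proof -
  have eq: "locus_term 1 z = cot z + cot z ^ 3" if "0 < z" "z < pi" for z
  proof -
    have s: "sin z \<noteq> 0"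
      using that sin_gt_zero by fastforce
    have "cot z + cot z ^ 3 = cos z * (sin z * sin z + cos z * cos z) / sin z ^ 3"
      using s by (simp add: cot_def field_simps power3_eq_cube del: sin_cos_squared_add3)
    also have "sin z * sin z + cos z * cos z = 1"
      by (metis sin_cos_squared_add power2_eq_square)
    finally show ?thesis
      by (simp add: locus_term_def eval_nat_numeral)
  qed
  have sx: "0 < sin x" and sy: "0 < sin y" and sd: "0 < sin (y - x)"
    using assms by (auto intro: sin_gt_zero)
  have "cot x - cot y = sin (y - x) / (sin x * sin y)"
    using sx sy by (simp add: cot_def sin_diff field_simps)
  also have "\<dots> > 0"
    using sx sy sd by simp
  finally have "cot y < cot x"
    by simp
  moreover have "cot y ^ 3 \<le> cot x ^ 3"
    using \<open>cot y < cot x\<close> by (intro power_mono_odd) auto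
  ultimately show ?thesis
    using assms eq[of x] eq[of y] by simp
qed

text \<open>The angles of the \<open>n\<close> lines lifted from \<open>\<real> / \<pi>\<int>\<close> to the real line, so that cyclic relabelling
  and reflection in a line become a translation and a reflection of the index set.\<close>

definition angle_seq :: "nat \<Rightarrow> (int \<Rightarrow> real) \<Rightarrow> bool" where
  "angle_seq n \<phi> \<longleftrightarrow> strict_mono \<phi> \<and> (\<forall>k. \<phi> (k + int n) = \<phi> k + pi)"

text \<open>For an angle sequence, the open window above \<open>k\<close> meets every other line
  once, with angle differences in (0, pi), where the force is monotone.\<close>

definition equilibrium :: "nat \<Rightarrow> (int \<Rightarrow> real) \<Rightarrow> (int \<Rightarrow> real) \<Rightarrow> bool" where
  "equilibrium n w \<phi> \<longleftrightarrow>
     (\<forall>k. (\<Sum>j\<in>{k<..<k + int n}. w j * locus_term 1 (\<phi> j - \<phi> k)) = 0)"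

lemma periodic_mod:
  fixes f :: "int \<Rightarrow> 'a"
  assumes "\<And>k. f (k + int n) = f k"
  shows "f (k mod int n) = f k"
proof -
  have *: "f (k + int n * int i) = f k" for k i
  proof (induction i)
    case (Suc i)
    then show ?case
      using assms[of "k + int n * int i"] by (simp add: algebra_simps)
  qed simp
  have "f (k + int n * z) = f k" for k z
    using *[of k "nat z"] *[of "k + int n * z" "nat (- z)"]
    by (cases "z \<ge> 0") (auto simp: algebra_simps)
  from this[of "k mod int n" "k div int n"] show ?thesis
    by simp
qed

text \<open>The window contains exactly one representative of each residue other than that of
  \<open>k\<close>; the inverse of reduction mod \<open>n\<close> picks the representative above
  \<open>k\<close>.\<close>

lemma sum_period:
  fixes f :: "int \<Rightarrow> 'a::comm_monoid_add"
  assumes "0 < n" and per: "\<And>k. f (k + int n) = f k"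
  shows "(\<Sum>j\<in>{k<..<k + int n}. f j) = (\<Sum>j\<in>{..<n} - {nat (k mod int n)}. f (int j))"
proof (rule sum.reindex_bij_witness[where
      j = "\<lambda>j. nat (j mod int n)" and i = "\<lambda>j. k + (int j - k) mod int n"], goal_cases)
  case (1 j)
  then have "(j - k) mod int n = j - k"
    by (intro mod_pos_pos_trivial) auto
  then show ?case
    using assms(1) by (simp add: mod_diff_left_eq)
next
  case (2 j)
  then have "(j - k) mod int n = j - k" "0 < j - k"
    by (auto intro: mod_pos_pos_trivial)
  then have "j mod int n \<noteq> k mod int n"
    by (metis mod_eq_dvd_iff dvd_imp_mod_0 less_irrefl)
  then show ?case
    using assms(1) by (simp add: nat_less_iff eq_nat_nat_iff)
next
  case (3 j)
  have "(k + (int j - k) mod int n) mod int n = int j mod int n"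
    by (simp add: mod_add_right_eq)
  also have "\<dots> = int j"
    using 3 by simp
  finally show ?case
    by simp
next
  case (4 j)
  have "(int j - k) mod int n \<noteq> 0"
  proof
    assume "(int j - k) mod int n = 0"
    then have "int j mod int n = k mod int n"
      by (simp add: mod_eq_dvd_iff mod_eq_0_iff_dvd)
    then show False
      using 4 by auto
  qed
  moreover have "0 \<le> (int j - k) mod int n" "(int j - k) mod int n < int n"
    using assms(1) by simp_all
  ultimately show ?case
    by simp
next
  case (5 j)
  then show ?case
    using assms(1) periodic_mod[of f n j, OF per] by simp
qed

lemma angle_seq_diff:
  assumes "angle_seq n \<phi>" "j \<in> {k<..<k + int n}"
  shows "0 < \<phi> j - \<phi> k" "\<phi> j - \<phi> k < pi"
  using assms strict_monoD[of \<phi> k j] strict_monoD[of \<phi> j "k + int n"]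
  by (auto simp: angle_seq_def)

text \<open>Maximum principle: where the difference of two equilibria is maximal, all terms of the
  first balance equation dominate those of the second.\<close>

lemma equilibrium_unique:
  assumes n: "0 < n" and w: "\<And>k. 0 < w k"
    and \<phi>: "angle_seq n \<phi>" "equilibrium n w \<phi>"
    and \<psi>: "angle_seq n \<psi>" "equilibrium n w \<psi>"
  shows "\<exists>c. \<forall>k. \<phi> k = \<psi> k + c"
proof -
  define d where "d k = \<phi> k - \<psi> k" for k
  have per: "d (k + int n) = d k" for k
    using \<phi>(1) \<psi>(1) by (simp add: angle_seq_def d_def)
  have d_mod: "d (k mod int n) = d k" for k
    by (rule periodic_mod[of d n, OF per])
  have fin: "finite (d ` {0..<int n})" "d ` {0..<int n} \<noteq> {}"
    using n by auto
  then obtain p where p: "p \<in> {0..<int n}" "d p = Max (d ` {0..<int n})"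
    using Max_in by (metis (no_types, lifting) imageE)
  \<comment> \<open>By periodicity, the maximum over one period is a global one.\<close>
  have max: "d k \<le> d p" for k
  proof -
    have "d (k mod int n) \<in> d ` {0..<int n}"
      using n by auto
    then show ?thesis
      unfolding p(2) using fin Max_ge d_mod by metis
  qed
  have le: "locus_term 1 (\<psi> j - \<psi> p) \<le> locus_term 1 (\<phi> j - \<phi> p)"
    and eq: "locus_term 1 (\<psi> j - \<psi> p) = locus_term 1 (\<phi> j - \<phi> p) \<Longrightarrow> d j = d p"
    if j: "j \<in> {p<..<p + int n}" for j
  proof -
    note bounds = angle_seq_diff[OF \<phi>(1) j] angle_seq_diff[OF \<psi>(1) j]
    have "\<phi> j - \<phi> p \<le> \<psi> j - \<psi> p"
      using max[of j] by (simp add: d_def)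
    then consider "\<phi> j - \<phi> p < \<psi> j - \<psi> p" | "\<phi> j - \<phi> p = \<psi> j - \<psi> p"
      by linarith
    then have "locus_term 1 (\<psi> j - \<psi> p) < locus_term 1 (\<phi> j - \<phi> p) \<or>
        \<phi> j - \<phi> p = \<psi> j - \<psi> p"
      using bounds locus_term_1_strict_antimono by cases auto
    then show "locus_term 1 (\<psi> j - \<psi> p) \<le> locus_term 1 (\<phi> j - \<phi> p)"
      and "locus_term 1 (\<psi> j - \<psi> p) = locus_term 1 (\<phi> j - \<phi> p) \<Longrightarrow> d j = d p"
      by (auto simp: d_def)
  qed
  let ?t = "\<lambda>j. w j * (locus_term 1 (\<phi> j - \<phi> p) - locus_term 1 (\<psi> j - \<psi> p))"
  have "(\<Sum>j\<in>{p<..<p + int n}. ?t j) = 0"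
    using \<phi>(2) \<psi>(2) by (simp add: equilibrium_def right_diff_distrib sum_subtractf)
  moreover have "0 \<le> ?t j" if "j \<in> {p<..<p + int n}" for j
    using le[OF that] w[of j] by simp
  ultimately have zero: "?t j = 0" if "j \<in> {p<..<p + int n}" for j
    using that sum_nonneg_eq_0_iff[of "{p<..<p + int n}" ?t] by blast
  have const: "d j = d p" if "j \<in> {p<..<p + int n}" for j
    using zero[OF that] eq[OF that] w[of j] by auto
  \<comment> \<open>Every index is congruent mod \<open>n\<close> to \<open>p\<close> or to a member
    of the window above \<open>p\<close>.\<close>
  have "d k = d p" for k
  proof -
    have "d (p + (k - p) mod int n) = d ((p + (k - p) mod int n) mod int n)"
      by (simp only: d_mod)
    also have "(p + (k - p) mod int n) mod int n = k mod int n"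
      by (simp add: mod_add_right_eq)
    finally have "d k = d (p + (k - p) mod int n)"
      by (simp add: d_mod)
    moreover have "0 \<le> (k - p) mod int n" "(k - p) mod int n < int n"
      using n by simp_all
    then have "(k - p) mod int n = 0 \<or> p + (k - p) mod int n \<in> {p<..<p + int n}"
      by (simp del: pos_mod_sign) linarith
    ultimately show ?thesis
      using const by auto
  qed
  then have "\<phi> k = \<psi> k + d p" for k
    using d_def[of k] by (metis add.commute diff_add_cancel)
  then show ?thesis
    by blast
qed

lemma sum_reflect:
  fixes f :: "int \<Rightarrow> 'a::comm_monoid_add"
  shows "(\<Sum>j\<in>{a<..<b}. f (c - j)) = (\<Sum>j\<in>{c - b<..<c - a}. f j)"
  by (rule sum.reindex_bij_witness[where i = "\<lambda>j. c - j" and j = "\<lambda>j. c - j"]) auto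

text \<open>The mirror image \<open>\<psi>\<close> is again an equilibrium for \<open>w\<close>,
  because \<open>w\<close> is symmetric about \<open>i\<close>. By uniqueness it is a translate of
  \<open>\<phi>\<close>, and comparing both at index \<open>i\<close> shows that the translation is
  by \<open>2 * \<phi> i\<close>.\<close>

lemma equilibrium_symmetric:
  assumes n: "0 < n" and w: "\<And>k. 0 < w k" "\<And>k. w (k + int n) = w k"
    and \<phi>: "angle_seq n \<phi>" "equilibrium n w \<phi>"
    and sym: "\<And>j. w (i + j) = w (i - j)"
  shows "\<phi> (2 * i - k) = 2 * \<phi> i - \<phi> k"
proof -
  define \<psi> where "\<psi> k = - \<phi> (2 * i - k)" for k
  have w_sym: "w (2 * i - k) = w k" for k
    using sym[of "i - k"] by (simp add: algebra_simps)
  have q: "\<phi> (k + int n) = \<phi> k + pi" for k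
    using \<phi>(1) by (simp add: angle_seq_def)
  have "\<psi> (k + int n) = \<psi> k + pi" for k
    using q[of "2 * i - (k + int n)"] by (simp add: \<psi>_def)
  moreover have "strict_mono \<psi>"
    using \<phi>(1) by (simp add: angle_seq_def \<psi>_def strict_mono_def)
  ultimately have "angle_seq n \<psi>"
    by (simp add: angle_seq_def)
  moreover have "equilibrium n w \<psi>"
    unfolding equilibrium_def
  proof
    fix k
    \<comment> \<open>The force on \<open>k\<close> in the mirror image is minus the force on the
      mirror index \<open>l\<close>, summed over the window below \<open>l\<close>.\<close>
    define l where "l = 2 * i - k"
    let ?f = "\<lambda>j. w j * locus_term 1 (\<phi> j - \<phi> l)"
    have per: "?f (j + int n) = ?f j" for j
      using locus_term_shift[of 1 "\<phi> j - \<phi> l"] by (simp add: w(2) q algebra_simps)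
    have "(\<Sum>j\<in>{k<..<k + int n}. w j * locus_term 1 (\<psi> j - \<psi> k))
        = (\<Sum>j\<in>{k<..<k + int n}. - ?f (2 * i - j))"
    proof (rule sum.cong)
      fix j
      show "w j * locus_term 1 (\<psi> j - \<psi> k) = - ?f (2 * i - j)"
        using locus_term_minus[of 1 "\<phi> (2 * i - j) - \<phi> l"] by (simp add: \<psi>_def l_def w_sym)
    qed simp
    also have "\<dots> = - (\<Sum>j\<in>{l - int n<..<l}. ?f j)"
      by (subst sum_reflect[where f = "\<lambda>j. - ?f j"]) (simp add: sum_negf l_def algebra_simps)
    \<comment> \<open>A shift by one period moves the window from below \<open>l\<close> to above
      it.\<close>
    also have "(\<Sum>j\<in>{l - int n<..<l}. ?f j) = (\<Sum>j\<in>{l<..<l + int n}. ?f j)"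
      by (rule sum.reindex_bij_witness[where i = "\<lambda>j. j - int n" and j = "\<lambda>j. j + int n"])
        (use per in auto)
    also have "\<dots> = 0"
      using \<phi>(2) by (simp add: equilibrium_def)
    finally show "(\<Sum>j\<in>{k<..<k + int n}. w j * locus_term 1 (\<psi> j - \<psi> k)) = 0"
      by simp
  qed
  ultimately obtain c where c: "\<And>k. \<phi> k = \<psi> k + c"
    using equilibrium_unique[OF n w(1) \<phi>] by blast
  show ?thesis
    using c[of i] c[of k] by (simp add: \<psi>_def)
qed

text \<open>Reflection about \<open>i\<close> negates the odd summands and permutes the window, so
  the sum equals its own negative.\<close>

lemma equilibrium_symmetric_locus:
  assumes n: "0 < n" and w: "\<And>k. 0 < w k" "\<And>k. w (k + int n) = w k"
    and \<phi>: "angle_seq n \<phi>" "equilibrium n w \<phi>"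
    and sym: "\<And>j. w (i + j) = w (i - j)" and "1 \<le> k"
  shows "(\<Sum>j\<in>{i<..<i + int n}. w j * locus_term k (\<phi> j - \<phi> i)) = 0"
proof -
  \<comment> \<open>The reflection \<open>2 * i - j\<close> lands below \<open>i\<close>; adding
    \<open>n\<close> returns it to the window and changes the angle only by pi.\<close>
  let ?c = "2 * i + int n"
  let ?f = "\<lambda>j. w j * locus_term k (\<phi> j - \<phi> i)"
  have "?f (?c - j) = - ?f j" for j
  proof -
    have c: "?c - j = (2 * i - j) + int n"
      by simp
    have "\<phi> (?c - j) = 2 * \<phi> i - \<phi> j + pi" "w (?c - j) = w j"
      unfolding c
      using \<phi>(1) equilibrium_symmetric[OF n w \<phi> sym, of j] w(2)[of "2 * i - j"] sym[of "i - j"]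
      by (simp_all add: angle_seq_def)
    moreover have "locus_term k (2 * \<phi> i - \<phi> j + pi - \<phi> i) = - locus_term k (\<phi> j - \<phi> i)"
      using locus_term_shift[OF \<open>1 \<le> k\<close>, of "\<phi> i - \<phi> j"] locus_term_minus[OF \<open>1 \<le> k\<close>, of "\<phi> j - \<phi> i"]
      by (simp add: algebra_simps)
    ultimately show ?thesis
      by simp
  qed
  then have "(\<Sum>j\<in>{i<..<i + int n}. ?f j) = - (\<Sum>j\<in>{i<..<i + int n}. ?f (?c - j))"
    by (simp add: sum_negf)
  also have "(\<Sum>j\<in>{i<..<i + int n}. ?f (?c - j)) = (\<Sum>j\<in>{i<..<i + int n}. ?f j)"
    by (subst sum_reflect[where f = ?f]) simp
  finally show ?thesis
    by simp
qed

subsection \<open>Existence of equilibria\<close>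

text \<open>Tychonoff's theorem, as the function type carries the product topology.\<close>

lemma compact_box_fun:
  fixes K :: "'a \<Rightarrow> 'b::topological_space set"
  assumes "\<And>i. compact (K i)"
  shows "compact {f. \<forall>i. f i \<in> K i}"
proof -
  have "compactin (product_topology (\<lambda>_. euclidean) UNIV) (PiE UNIV K)"
    using assms by (simp add: compactin_PiE)
  moreover have "PiE UNIV K = {f. \<forall>i. f i \<in> K i}"
    by auto
  ultimately show ?thesis
    by (simp add: euclidean_product_topology)
qed

text \<open>The derivative of 1 / sin^2 is \<open>-2 * locus_term 1\<close>, so away from collisions
  critical points are balanced. Each unordered pair counts twice.\<close>

definition energy :: "nat \<Rightarrow> (nat \<Rightarrow> real) \<Rightarrow> (nat \<Rightarrow> real) \<Rightarrow> real" where
  "energy n w x = (\<Sum>i<n. \<Sum>j<n. w i * w j / sin (x i - x j) ^ 2)"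

text \<open>Diagonal terms vanish because of \<open>1 / 0 = 0\<close>.\<close>

lemma energy_split:
  assumes "k < n"
  shows "energy n w x =
    (\<Sum>i\<in>{..<n} - {k}. \<Sum>j\<in>{..<n} - {k}. w i * w j / sin (x i - x j) ^ 2)
      + 2 * w k * (\<Sum>j\<in>{..<n} - {k}. w j / sin (x j - x k) ^ 2)"
proof -
  let ?a = "\<lambda>i j. w i * w j / sin (x i - x j) ^ 2"
  let ?S = "{..<n} - {k}"
  have sym: "?a k j = ?a j k" for j
    using sin_minus[of "x j - x k"] by (simp add: mult.commute)
  have row: "(\<Sum>j<n. ?a i j) = ?a i k + (\<Sum>j\<in>?S. ?a i j)" for i
    using assms by (intro sum.remove) auto
  have "energy n w x = (\<Sum>j<n. ?a k j) + (\<Sum>i\<in>?S. \<Sum>j<n. ?a i j)"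
    unfolding energy_def using assms by (intro sum.remove) auto
  also have "\<dots> = (\<Sum>i\<in>?S. \<Sum>j\<in>?S. ?a i j) + 2 * (\<Sum>j\<in>?S. ?a j k)"
    unfolding row by (simp add: sum.distrib sym)
  also have "(\<Sum>j\<in>?S. ?a j k) = w k * (\<Sum>j\<in>?S. w j / sin (x j - x k) ^ 2)"
    by (simp add: sum_distrib_left mult.commute)
  finally show ?thesis
    by simp
qed

text \<open>All terms are nonnegative and the weights are at least 1, so a single close pair already
  makes the energy large.\<close>

lemma energy_ge_pair:
  assumes "i < n" "j < n" "\<And>i. i < n \<Longrightarrow> 1 \<le> w i"
  shows "1 / sin (x i - x j) ^ 2 \<le> energy n w x"
proof -
  have nonneg: "0 \<le> w k * w l / sin (x k - x l) ^ 2" if "k < n" "l < n" for k l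
    using that assms(3)[of k] assms(3)[of l] by simp
  have "1 * 1 \<le> w i * w j"
    using assms(3)[of i] assms(3)[of j] assms(1,2) by (intro mult_mono) auto
  then have "1 / sin (x i - x j) ^ 2 \<le> w i * w j / sin (x i - x j) ^ 2"
    by (intro divide_right_mono) auto
  also have "\<dots> \<le> (\<Sum>l<n. w i * w l / sin (x i - x l) ^ 2)"
    using assms nonneg by (intro member_le_sum) auto
  also have "\<dots> \<le> energy n w x"
    unfolding energy_def using assms nonneg
    by (intro member_le_sum[where f = "\<lambda>i. \<Sum>l<n. w i * w l / sin (x i - x l) ^ 2"] sum_nonneg) auto
  finally show ?thesis .
qed

text \<open>The derivative of the energy in coordinate \<open>k\<close> is \<open>4 * w k\<close>
  times the force on particle \<open>k\<close>, and it vanishes at a local minimum.\<close>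

lemma balance_at_local_min:
  assumes "k < n" "w k > 0" and neq: "\<And>j. j < n \<Longrightarrow> j \<noteq> k \<Longrightarrow> sin (x j - x k) \<noteq> 0"
    and min: "\<forall>\<^sub>F t in nhds (x k). energy n w x \<le> energy n w (x(k := t))"
  shows "(\<Sum>j<n. w j * locus_term 1 (x j - x k)) = 0"
proof -
  let ?S = "{..<n} - {k}"
  define u where "u t = (\<Sum>j\<in>?S. w j / sin (x j - t) ^ 2)" for t
  \<comment> \<open>\<open>R\<close> is the energy of the pairs that avoid \<open>k\<close>, which
    is independent of \<open>t\<close>.\<close>
  obtain R where R: "energy n w (x(k := t)) = R + 2 * w k * u t" for t
  proof
    fix t
    show "energy n w (x(k := t)) =
      (\<Sum>i\<in>?S. \<Sum>j\<in>?S. w i * w j / sin (x i - x j) ^ 2) + 2 * w k * u t"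
      unfolding energy_split[OF \<open>k < n\<close>] u_def by simp
  qed
  have "energy n w x = R + 2 * w k * u (x k)"
    using R[of "x k"] by simp
  then have "\<forall>\<^sub>F t in nhds (x k). u (x k) \<le> u t"
    using min \<open>w k > 0\<close> by (simp add: R)
  then obtain d where d: "0 < d" "\<forall>t. \<bar>x k - t\<bar> < d \<longrightarrow> u (x k) \<le> u t"
    by (auto simp: eventually_nhds_metric dist_real_def abs_minus_commute)
  have "((\<lambda>t. w j / sin (x j - t) ^ 2) has_real_derivative
      2 * (w j * locus_term 1 (x j - x k))) (at (x k))" if "j \<in> ?S" for j
  proof -
    have "sin (x j - x k) \<noteq> 0"
      using that neq by auto
    then show ?thesis
      by (auto intro!: derivative_eq_intros
          simp: locus_term_def field_simps eval_nat_numeral)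
  qed
  then have "(u has_real_derivative (\<Sum>j\<in>?S. 2 * (w j * locus_term 1 (x j - x k)))) (at (x k))"
    unfolding u_def by (rule DERIV_sum)
  then have "(\<Sum>j\<in>?S. 2 * (w j * locus_term 1 (x j - x k))) = 0"
    using d by (rule DERIV_local_min)
  then have "(\<Sum>j\<in>?S. w j * locus_term 1 (x j - x k)) = 0"
    by (simp flip: sum_distrib_left)
  then show ?thesis
    using \<open>k < n\<close> by (subst sum.remove[of _ k]) auto
qed

text \<open>Action equals reaction: exchanging the two summation indices negates the double sum.
  This yields the balance at the particle that the minimization holds fixed.\<close>

lemma total_force_zero:
  "(\<Sum>k<n. w k * (\<Sum>j<n. w j * locus_term 1 (x j - x k))) = 0" (is "?T = 0")
proof -
  have "?T = (\<Sum>k<n. \<Sum>j<n. w k * (w j * locus_term 1 (x j - x k)))"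
    by (simp add: sum_distrib_left)
  also have "\<dots> = (\<Sum>j<n. \<Sum>k<n. w k * (w j * locus_term 1 (x j - x k)))"
    by (rule sum.swap)
  also have "\<dots> = (\<Sum>j<n. \<Sum>k<n. - (w j * (w k * locus_term 1 (x k - x j))))"
  proof (intro sum.cong refl)
    fix j k
    show "w k * (w j * locus_term 1 (x j - x k)) = - (w j * (w k * locus_term 1 (x k - x j)))"
      using locus_term_minus[of 1 "x k - x j"] by simp
  qed
  also have "\<dots> = - ?T"
    by (simp add: sum_distrib_left sum_negf)
  finally show ?thesis
    by simp
qed

text \<open>The energy is minimized over a compact set with particle 0 pinned and all gaps at least
  \<open>\<delta>\<close> modulo pi. For small \<open>\<delta>\<close> the gap constraints are
  strict at the minimizer, so every other particle can move freely and is balanced.\<close>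

lemma equilibrium_exists:
  fixes n :: nat and w :: "nat \<Rightarrow> real"
  assumes n: "0 < n" and w: "\<And>i. i < n \<Longrightarrow> 1 \<le> w i"
  obtains x where "x 0 = 0" "\<And>i j. i < j \<Longrightarrow> j < n \<Longrightarrow> x i < x j" "\<And>i. i < n \<Longrightarrow> x i < pi"
    "\<And>k. k < n \<Longrightarrow> (\<Sum>j<n. w j * locus_term 1 (x j - x k)) = 0"
proof -
  \<comment> \<open>Equally spaced particles serve as the competitor whose energy bounds the
    minimum.\<close>
  define e where "e i = pi * real i / real n" for i
  define E where "E = energy n w e"
  have "0 \<le> E"
    using energy_ge_pair[OF n n w, where x = e] by (simp add: E_def)
  \<comment> \<open>The bound \<open>pi / n\<close> admits the competitor; the bound
    \<open>1 / (E + 1)\<close> makes a pair at distance \<open>\<delta>\<close> cost more than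
    \<open>E\<close>.\<close>
  define \<delta> where "\<delta> = min (pi / n) (1 / (E + 1))"
  have \<delta>: "0 < \<delta>" "\<delta> \<le> pi / n" "\<delta> \<le> 1 / (E + 1)"
    using n \<open>0 \<le> E\<close> by (auto simp: \<delta>_def)
  have "\<delta> \<le> 1"
    using \<delta>(3) \<open>0 \<le> E\<close> by (smt (verit) divide_le_eq_1)
  have sin_pos: "0 < sin \<delta>"
    using \<delta>(1) \<open>\<delta> \<le> 1\<close> pi_gt3 by (intro sin_gt_zero) auto
  have large: "E < 1 / sin \<delta> ^ 2"
  proof -
    have "sin \<delta> ^ 2 \<le> \<delta> ^ 2"
      using sin_pos sin_x_le_x[of \<delta>] \<delta>(1) by (intro power_mono) auto
    also have "\<dots> \<le> \<delta>"
      using \<delta>(1) \<open>\<delta> \<le> 1\<close> by (simp add: power2_eq_square mult_left_le)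
    also have "\<dots> \<le> 1 / (E + 1)"
      by (rule \<delta>)
    finally have "E + 1 \<le> 1 / sin \<delta> ^ 2"
      using sin_pos \<open>0 \<le> E\<close> by (simp add: field_simps)
    then show ?thesis
      by simp
  qed
  \<comment> \<open>A difference near pi is also a collision, since lines have angles modulo pi;
    hence the upper bound.\<close>
  define gap where "gap y \<longleftrightarrow> (\<forall>i<n. \<forall>j<n. i < j \<longrightarrow> y j - y i \<in> {\<delta>..pi - \<delta>})"
    for y :: "nat \<Rightarrow> real"
  \<comment> \<open>Pinning coordinate 0 removes the rotational freedom; pinning those from
    \<open>n\<close> on makes the set compact in the whole function space.\<close>
  define C where "C = {y. \<forall>i. y i \<in> (if 0 < i \<and> i < n then {0..pi} else {0})} \<inter> {y. gap y}"
  have coord: "continuous_on A (\<lambda>y::nat \<Rightarrow> real. y i)" for A i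
    by (rule continuous_on_subset[OF continuous_on_product_coordinates]) simp
  have "closed {y. gap y}"
  proof -
    have "{y. gap y} = (\<Inter>i\<in>{..<n}. \<Inter>j\<in>{i<..<n}. {y. \<delta> \<le> y j - y i} \<inter> {y. y j - y i \<le> pi - \<delta>})"
      by (fastforce simp: gap_def)
    also have "closed \<dots>"
      by (intro closed_INT ballI closed_Int closed_Collect_le continuous_intros coord)
    finally show ?thesis .
  qed
  then have "compact C"
    unfolding C_def by (intro compact_Int_closed compact_box_fun) auto
  \<comment> \<open>On [\<open>\<delta>\<close>, pi - \<open>\<delta>\<close>] the sine is smallest
    at the endpoints. This keeps the denominators nonzero, hence the energy continuous on
    \<open>C\<close>.\<close>
  have sin_ge: "sin \<delta> \<le> \<bar>sin (y i - y j)\<bar>" if "gap y" "i < n" "j < n" "i \<noteq> j" for y i j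
  proof -
    have *: "sin \<delta> \<le> sin t" if "t \<in> {\<delta>..pi - \<delta>}" for t
    proof (cases "t \<le> pi / 2")
      case True
      then show ?thesis
        using that \<delta>(1) by (intro sin_monotone_2pi_le) auto
    next
      case False
      then have "sin \<delta> \<le> sin (pi - t)"
        using that \<delta>(1) by (intro sin_monotone_2pi_le) auto
      then show ?thesis
        by simp
    qed
    consider "i < j" | "j < i"
      using \<open>i \<noteq> j\<close> by linarith
    then show ?thesis
    proof cases
      case 1
      then have "sin \<delta> \<le> sin (y j - y i)"
        using that by (intro *) (auto simp: gap_def)
      then show ?thesis
        using sin_minus[of "y j - y i"] by simp
    next
      case 2
      then have "sin \<delta> \<le> sin (y i - y j)"
        using that by (intro *) (auto simp: gap_def)
      then show ?thesis
        by simp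
    qed
  qed
  have "continuous_on C (energy n w)"
    unfolding energy_def
  proof (intro continuous_on_sum)
    fix i j assume ij: "i \<in> {..<n}" "j \<in> {..<n}"
    show "continuous_on C (\<lambda>y. w i * w j / sin (y i - y j) ^ 2)"
    proof (cases "i = j")
      case False
      have "sin (y i - y j) \<noteq> 0" if "y \<in> C" for y
        using sin_ge[of y i j] that ij False sin_pos by (auto simp: C_def)
      then show ?thesis
        by (intro continuous_intros coord) auto
    qed simp
  qed
  moreover have "e' \<in> C" and e'_energy: "energy n w e' = E"
    if "e' = (\<lambda>i. if i < n then e i else 0)" for e'
  proof -
    have "e j - e i \<in> {\<delta>..pi - \<delta>}" if "i < j" "j < n" for i j
    proof -
      have eq: "e j - e i = pi / n * real (j - i)"
        using that by (simp add: e_def of_nat_diff field_simps)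
      have "pi / n * 1 \<le> pi / n * real (j - i)"
        using that by (intro mult_left_mono) auto
      moreover have "pi / n * real (j - i) \<le> pi / n * (real n - 1)"
        using that by (intro mult_left_mono) auto
      moreover have "pi / n * (real n - 1) = pi - pi / n"
        using n by (simp add: field_simps)
      ultimately show ?thesis
        using \<delta>(2) eq by auto
    qed
    moreover have "e i \<in> {0..pi}" if "i < n" for i
      using that by (simp add: e_def field_simps)
    ultimately show "e' \<in> C"
      using n by (auto simp: that C_def gap_def) (auto simp: e_def)
    show "energy n w e' = E"
      by (simp add: energy_def E_def that)
  qed
  ultimately obtain x where x: "x \<in> C" and min: "\<And>y. y \<in> C \<Longrightarrow> energy n w x \<le> energy n w y"
    using continuous_attains_inf[OF \<open>compact C\<close>, of "energy n w"] by blast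
  have "energy n w x \<le> E"
    using min e'_energy \<open>\<And>e'. _ \<Longrightarrow> e' \<in> C\<close> by metis
  have x0: "x 0 = 0"
    using x by (auto simp: C_def dest: spec[of _ 0])
  \<comment> \<open>At either endpoint that pair alone would have energy at least
    \<open>1 / sin \<delta> ^ 2\<close>, exceeding \<open>E\<close>.\<close>
  have gap_x: "x j - x i \<in> {\<delta><..<pi - \<delta>}" if "i < j" "j < n" for i j
  proof -
    have "x j - x i \<in> {\<delta>..pi - \<delta>}"
      using x that by (auto simp: C_def gap_def)
    moreover have "sin (x j - x i) ^ 2 \<noteq> sin \<delta> ^ 2"
      using energy_ge_pair[of j n i w x] that w large \<open>energy n w x \<le> E\<close> by auto
    then have "x j - x i \<noteq> \<delta>" "x j - x i \<noteq> pi - \<delta>"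
      by (metis, metis sin_pi_minus)
    ultimately show ?thesis
      by auto
  qed
  have pos: "(\<Sum>j<n. w j * locus_term 1 (x j - x k)) = 0" if k: "0 < k" "k < n" for k
  proof (rule balance_at_local_min)
    show "0 < w k"
      using w[OF k(2)] by simp
    show "sin (x j - x k) \<noteq> 0" if "j < n" "j \<noteq> k" for j
      using sin_ge[of x j k] x that k sin_pos by (auto simp: C_def)
    \<comment> \<open>The strict gap conditions are open, so small moves of particle
      \<open>k\<close> stay in \<open>C\<close>.\<close>
    have "\<forall>\<^sub>F t in nhds (x k). (x(k := t)) j - (x(k := t)) i \<in> {\<delta><..<pi - \<delta>}"
      if "i < j" "j < n" for i j
    proof -
      have "((\<lambda>t. (x(k := t)) j - (x(k := t)) i) \<longlongrightarrow> x j - x i) (nhds (x k))"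
        by (cases "j = k"; cases "i = k")
           (auto intro!: tendsto_eq_intros filterlim_ident)
      then show ?thesis
        using gap_x[OF that] by (rule topological_tendstoD[OF _ open_greaterThanLessThan])
    qed
    then have "\<forall>\<^sub>F t in nhds (x k). \<forall>j\<in>{..<n}. \<forall>i\<in>{..<j}. (x(k := t)) j - (x(k := t)) i \<in> {\<delta><..<pi - \<delta>}"
      by (intro eventually_ball_finite ballI) auto
    then show "\<forall>\<^sub>F t in nhds (x k). energy n w x \<le> energy n w (x(k := t))"
    proof eventually_elim
      case (elim t)
      let ?y = "x(k := t)"
      have g: "?y j - ?y i \<in> {\<delta><..<pi - \<delta>}" if "i < j" "j < n" for i j
        using elim that by blast
      have "?y j - ?y i \<in> {\<delta>..pi - \<delta>}" if "i < j" "j < n" for i j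
        using g[OF that] by (simp del: fun_upd_apply)
      then have "gap ?y"
        unfolding gap_def by blast
      \<comment> \<open>This is the gap condition relative to particle 0, which sits at 0.\<close>
      moreover have "t \<in> {0..pi}"
        using g[of 0 k] k \<delta>(1) x0 by simp
      then have "?y i \<in> (if 0 < i \<and> i < n then {0..pi} else {0})" for i
        using x k by (cases "i = k") (auto simp: C_def)
      ultimately show ?case
        by (intro min) (simp only: C_def Int_iff mem_Collect_eq, blast)
    qed
  qed (use k in auto)
  \<comment> \<open>All other particles being balanced, only the force on particle 0 survives in the
    total.\<close>
  have "(\<Sum>k<n. w k * (\<Sum>j<n. w j * locus_term 1 (x j - x k)))
      = w 0 * (\<Sum>j<n. w j * locus_term 1 (x j - x 0))"
    using n pos by (subst sum.remove[of _ 0]) auto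
  then have zero: "(\<Sum>j<n. w j * locus_term 1 (x j - x 0)) = 0"
    using total_force_zero[of w x n] w[OF n] by simp
  show thesis
  proof (rule that[of x])
    show "x 0 = 0"
      by (rule x0)
    show "x i < x j" if "i < j" "j < n" for i j
      using gap_x[OF that] \<delta>(1) by simp
    show "x i < pi" if "i < n" for i
      using gap_x[of 0 i] that x0 \<delta>(1) by (cases "i = 0") auto
    show "(\<Sum>j<n. w j * locus_term 1 (x j - x k)) = 0" if "k < n" for k
      using that zero pos by (cases "k = 0") auto
  qed
qed

subsection \<open>Lines and angles\<close>

definition unit_normal :: "real \<Rightarrow> complex^2" where
  "unit_normal t = vector [complex_of_real (cos t), complex_of_real (sin t)]"

definition direction :: "real \<Rightarrow> complex^2" where
  "direction t = vector [complex_of_real (- sin t), complex_of_real (cos t)]"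

lemma scalar_product_2: "scalar_product v w = v $ 1 * w $ 1 + v $ 2 * w $ 2" for v w :: "complex^2"
  by (simp add: scalar_product_def sum_2)

lemma scalar_product_scale:
  fixes v w :: "complex^2"
  shows "scalar_product (c *s v) w = c * scalar_product v w"
    and "scalar_product v (c *s w) = c * scalar_product v w"
  by (simp_all add: scalar_product_2 algebra_simps)

lemma scalar_product_unit_normal:
  "scalar_product (unit_normal a) (unit_normal b) = of_real (cos (a - b))"
  by (simp add: scalar_product_2 unit_normal_def cos_diff)

lemma scalar_product_unit_normal_direction:
  "scalar_product (unit_normal a) (direction b) = of_real (sin (a - b))"
  by (simp add: scalar_product_2 unit_normal_def direction_def sin_diff algebra_simps)

text \<open>The two real vectors are orthonormal for the bilinear form, so they also give
  coordinates for complex vectors.\<close>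

lemma vector_decompose:
  fixes v :: "complex^2"
  shows "v = scalar_product (unit_normal t) v *s unit_normal t + scalar_product v (direction t) *s direction t"
proof -
  define c s where "c = complex_of_real (cos t)" and "s = complex_of_real (sin t)"
  have cs: "c * c + s * s = 1"
    unfolding c_def s_def by (metis of_real_1 of_real_add of_real_mult sin_cos_squared_add3)
  have "v $ 1 = (c * v $ 1 + s * v $ 2) * c + (v $ 2 * c - v $ 1 * s) * (- s)"
    using cs by algebra
  moreover have "v $ 2 = (c * v $ 1 + s * v $ 2) * s + (v $ 2 * c - v $ 1 * s) * c"
    using cs by algebra
  ultimately show ?thesis
    by (simp add: vec_eq_iff forall_2 scalar_product_2 unit_normal_def direction_def algebra_simps
        flip: c_def s_def)
qed

lemma hyp_scale: "c \<noteq> 0 \<Longrightarrow> hyp (c *s v) = hyp v"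
  by (simp add: hyp_def scalar_product_scale)

lemma scale_direction_in_hyp_iff:
  "c *s direction b \<in> hyp (unit_normal a) \<longleftrightarrow> c = 0 \<or> sin (a - b) = 0"
  by (simp add: hyp_def scalar_product_scale scalar_product_unit_normal_direction)

lemma hyp_unit_normal: "hyp (unit_normal t) = range (\<lambda>c. c *s direction t)"
proof -
  have "\<exists>c. v = c *s direction t" if "v \<in> hyp (unit_normal t)" for v
    using vector_decompose[of v t] that by (auto simp: hyp_def)
  then show ?thesis
    using scale_direction_in_hyp_iff[of _ t t] by auto
qed

lemma hyp_unit_normal_eq_iff: "hyp (unit_normal a) = hyp (unit_normal b) \<longleftrightarrow> sin (a - b) = 0"
proof
  assume "hyp (unit_normal a) = hyp (unit_normal b)"
  then show "sin (a - b) = 0"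
    using scale_direction_in_hyp_iff[of 1 b a] scale_direction_in_hyp_iff[of 1 b b] by simp
next
  have sub: "hyp (unit_normal b) \<subseteq> hyp (unit_normal a)" if "sin (a - b) = 0" for a b
    using that scale_direction_in_hyp_iff[of _ b a] unfolding hyp_unit_normal[of b] by auto
  assume "sin (a - b) = 0"
  then show "hyp (unit_normal a) = hyp (unit_normal b)"
    using sub[of a b] sub[of b a] sin_minus[of "a - b"] by auto
qed

text \<open>As \<open>direction t\<close> lies on the line, the component of \<open>\<alpha>\<close>
  along it vanishes; the remaining coefficient is nonzero because \<open>\<alpha>\<close> is not
  isotropic.\<close>

lemma normal_of_hyp_unit_normal:
  assumes "hyp \<alpha> = hyp (unit_normal t)" "scalar_product \<alpha> \<alpha> \<noteq> 0"
  obtains c where "c \<noteq> 0" "\<alpha> = c *s unit_normal t"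
proof
  have "direction t \<in> hyp \<alpha>"
    using scale_direction_in_hyp_iff[of 1 t t] assms(1) by simp
  then show *: "\<alpha> = scalar_product (unit_normal t) \<alpha> *s unit_normal t"
    using vector_decompose[of \<alpha> t] by (simp add: hyp_def)
  show "scalar_product (unit_normal t) \<alpha> \<noteq> 0"
  proof
    assume "scalar_product (unit_normal t) \<alpha> = 0"
    with * have "\<alpha> = 0"
      by simp
    then show False
      using assms(2) by (simp add: scalar_product_2)
  qed
qed

text \<open>Write each normal as \<open>c j\<close> times a unit normal and a point of the line as
  \<open>d\<close> times its direction. Then \<open>c j\<close> cancels by homogeneity, and
  \<open>c i\<close> and \<open>d\<close> contribute a factor common to all summands, leaving a real
  sum.\<close>

lemma locus_equation_angles:
  fixes x :: "nat \<Rightarrow> real"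
  defines "H \<equiv> \<lambda>i. hyp (unit_normal (x i))"
  assumes inj: "inj_on H {..<n}" and lines: "lines A = H ` {..<n}" and \<alpha>: "normals A \<alpha>"
    and i: "i < n" and k: "1 \<le> k"
  shows "locus_equation A \<alpha> (H i) k \<longleftrightarrow>
    (\<Sum>j\<in>{..<n} - {i}. real (mult A (H j) * (mult A (H j) + 1)) * locus_term k (x j - x i)) = 0"
    (is "_ \<longleftrightarrow> ?S = 0")
proof -
  have "\<exists>c. c \<noteq> 0 \<and> \<alpha> (H j) = c *s unit_normal (x j)" if "j < n" for j
  proof -
    have "hyp (\<alpha> (H j)) = hyp (unit_normal (x j))" "scalar_product (\<alpha> (H j)) (\<alpha> (H j)) \<noteq> 0"
      using \<alpha> that lines by (auto simp: normals_def H_def)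
    then show ?thesis
      by (metis normal_of_hyp_unit_normal)
  qed
  then obtain c where c: "\<And>j. j < n \<Longrightarrow> c j \<noteq> 0"
    and \<alpha>_eq: "\<And>j. j < n \<Longrightarrow> \<alpha> (H j) = c j *s unit_normal (x j)"
    by metis
  have rest: "lines A - {H i} = H ` ({..<n} - {i})"
    using inj lines i by (auto simp: inj_on_def)
  \<comment> \<open>The identity includes \<open>d = 0\<close>, where both sides are 0 by division
    by zero.\<close>
  have sum: "(\<Sum>K\<in>lines A - {H i}.
      of_nat (mult A K * (mult A K + 1)) * scalar_product (\<alpha> K) (\<alpha> K)
        * scalar_product (\<alpha> K) (\<alpha> (H i)) ^ (2 * k - 1)
        / scalar_product (\<alpha> K) (d *s direction (x i)) ^ (2 * k + 1))
      = c i ^ (2 * k - 1) / d ^ (2 * k + 1) * of_real ?S" for d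
  proof -
    have "of_nat (mult A (H j) * (mult A (H j) + 1)) * scalar_product (\<alpha> (H j)) (\<alpha> (H j))
        * scalar_product (\<alpha> (H j)) (\<alpha> (H i)) ^ (2 * k - 1)
        / scalar_product (\<alpha> (H j)) (d *s direction (x i)) ^ (2 * k + 1)
      = c i ^ (2 * k - 1) / d ^ (2 * k + 1)
        * of_real (real (mult A (H j) * (mult A (H j) + 1)) * locus_term k (x j - x i))"
      (is "?l = ?r") if "j < n" for j
    proof -
      define M C S where "M = complex_of_nat (mult A (H j) * (mult A (H j) + 1))"
        and "C = complex_of_real (cos (x j - x i))" and "S = complex_of_real (sin (x j - x i))"
      \<comment> \<open>Two factors \<open>c j\<close> come from the norm and
        \<open>2 * k - 1\<close> from the product with the normal of \<open>H i\<close>, matching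
        the denominator.\<close>
      have "2 * k + 1 = 2 + (2 * k - 1)"
        using k by simp
      then have pow: "c j ^ (2 * k + 1) = c j * c j * c j ^ (2 * k - 1)"
        by (metis power_add power2_eq_square)
      have "?l = M * (c j * c j) * (c j * c i * C) ^ (2 * k - 1) / (c j * d * S) ^ (2 * k + 1)"
        unfolding \<alpha>_eq[OF that] \<alpha>_eq[OF i] scalar_product_scale scalar_product_unit_normal
          scalar_product_unit_normal_direction
        by (simp add: M_def C_def S_def mult_ac)
      also have "\<dots> = c j ^ (2 * k + 1) * (M * c i ^ (2 * k - 1) * C ^ (2 * k - 1))
          / (c j ^ (2 * k + 1) * (d ^ (2 * k + 1) * S ^ (2 * k + 1)))"
        unfolding power_mult_distrib pow by (simp only: mult_ac)
      also have "\<dots> = M * c i ^ (2 * k - 1) * C ^ (2 * k - 1) / (d ^ (2 * k + 1) * S ^ (2 * k + 1))"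
        using c[OF that] by (intro mult_divide_mult_cancel_left) simp
      also have "\<dots> = ?r"
        by (simp add: M_def C_def S_def locus_term_def mult_ac)
      finally show ?thesis .
    qed
    then show ?thesis
      unfolding rest using inj
      by (subst sum.reindex) (auto simp: inj_on_def sum_distrib_left intro!: sum.cong)
  qed
  show ?thesis
  proof
    assume eq: "locus_equation A \<alpha> (H i) k"
    \<comment> \<open>The equation is tested at the point with \<open>d = 1\<close>, which lies on
      no other line.\<close>
    have "1 *s direction (x i) \<in> H i"
      unfolding H_def scale_direction_in_hyp_iff by simp
    moreover have "1 *s direction (x i) \<notin> K" if "K \<in> lines A - {H i}" for K
    proof -
      from that obtain j where "K = H j" "H j \<noteq> H i"
        unfolding lines by blast
      then show ?thesis
        using scale_direction_in_hyp_iff[of 1 "x i" "x j"] by (simp add: H_def hyp_unit_normal_eq_iff)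
    qed
    ultimately have "c i ^ (2 * k - 1) / 1 ^ (2 * k + 1) * of_real ?S = (0::complex)"
      using eq unfolding locus_equation_def sum[symmetric] by blast
    then show "?S = 0"
      using c[OF i] by (simp only: power_one div_by_1 mult_eq_0_iff power_not_zero of_real_eq_0_iff simp_thms)
  next
    assume S: "?S = 0"
    show "locus_equation A \<alpha> (H i) k"
      unfolding locus_equation_def
    proof (intro ballI impI)
      fix v assume "v \<in> H i"
      then obtain d where v: "v = d *s direction (x i)"
        unfolding H_def hyp_unit_normal by blast
      show "(\<Sum>K\<in>lines A - {H i}.
          of_nat (mult A K * (mult A K + 1)) * scalar_product (\<alpha> K) (\<alpha> K)
            * scalar_product (\<alpha> K) (\<alpha> (H i)) ^ (2 * k - 1)
            / scalar_product (\<alpha> K) v ^ (2 * k + 1)) = 0"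
        unfolding v sum S by simp
    qed
  qed
qed

section \<open>Lifting cyclically ordered angles to the real line\<close>

definition angle_extension :: "nat \<Rightarrow> (nat \<Rightarrow> real) \<Rightarrow> int \<Rightarrow> real" where
  "angle_extension n x k = x (nat (k mod int n)) + pi * of_int (k div int n)"

lemma angle_extension_of_nat: "i < n \<Longrightarrow> angle_extension n x (int i) = x i"
  by (simp add: angle_extension_def)

text \<open>Within a period monotonicity is that of \<open>x\<close>; between periods it holds
  because all angles lie within less than pi of each other.\<close>

lemma angle_seq_extension:
  assumes n: "0 < n" and mono: "\<And>i j. i < j \<Longrightarrow> j < n \<Longrightarrow> x i < x j"
    and range: "\<And>i j. i < n \<Longrightarrow> j < n \<Longrightarrow> x j < x i + pi"
  shows "angle_seq n (angle_extension n x)"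
  unfolding angle_seq_def
proof (intro conjI allI strict_monoI)
  fix k l :: int
  assume "k < l"
  have bounds: "0 \<le> z mod int n" "z mod int n < int n" for z
    using n by simp_all
  have "k div int n \<le> l div int n"
    using \<open>k < l\<close> n by (intro zdiv_mono1) auto
  then consider "k div int n = l div int n" | "k div int n + 1 \<le> l div int n"
    by linarith
  then show "angle_extension n x k < angle_extension n x l"
  proof cases
    case 1
    then have "k mod int n < l mod int n"
      using \<open>k < l\<close> by (metis add_less_cancel_left mult_div_mod_eq)
    then have "x (nat (k mod int n)) < x (nat (l mod int n))"
      using bounds(1)[of k] bounds[of l] by (intro mono) linarith+
    then show ?thesis
      using 1 by (simp add: angle_extension_def)
  next
    case 2
    have "x (nat (k mod int n)) < x (nat (l mod int n)) + pi"
      using bounds n by (intro range) (auto simp: nat_less_iff)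
    moreover have "pi * (of_int (k div int n) + 1) \<le> pi * of_int (l div int n)"
      using 2 pi_gt_zero by (intro mult_left_mono) linarith+
    ultimately show ?thesis
      by (simp add: angle_extension_def algebra_simps)
  qed
next
  fix k
  show "angle_extension n x (k + int n) = angle_extension n x k + pi"
    using n by (simp add: angle_extension_def algebra_simps)
qed

lemma locus_sum_period:
  assumes n: "0 < n" and \<phi>: "angle_seq n \<phi>" and w: "\<And>k. w (k + int n) = w k" and k: "1 \<le> k"
  shows "(\<Sum>j\<in>{i<..<i + int n}. w j * locus_term k (\<phi> j - \<phi> i)) =
    (\<Sum>j\<in>{..<n} - {nat (i mod int n)}.
       w (int j) * locus_term k (\<phi> (int j) - \<phi> (int (nat (i mod int n)))))"
proof -
  have q: "\<phi> (l + int n) = \<phi> l + pi" for l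
    using \<phi> by (simp add: angle_seq_def)
  have base: "locus_term k (c - \<phi> (i mod int n)) = locus_term k (c - \<phi> i)" for c
  proof (rule periodic_mod[of "\<lambda>l. locus_term k (c - \<phi> l)"])
    fix l
    show "locus_term k (c - \<phi> (l + int n)) = locus_term k (c - \<phi> l)"
      using locus_term_shift[OF k, of "c - \<phi> l - pi"] by (simp add: q algebra_simps)
  qed
  have "w (j + int n) * locus_term k (\<phi> (j + int n) - \<phi> i) = w j * locus_term k (\<phi> j - \<phi> i)" for j
    using locus_term_shift[OF k, of "\<phi> j - \<phi> i"] by (simp add: w q algebra_simps)
  then show ?thesis
    using n by (subst sum_period) (simp_all add: base)
qed

text \<open>Some rotation of the list has increasing half-angles in [0, pi). They are extended
  periodically, and an index shift then restores the original labelling.\<close>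

lemma has_cyc_mults_angle_seq:
  assumes "has_cyc_mults A m" and n: "0 < length m"
  obtains \<phi> Hs where "angle_seq (length m) \<phi>" "distinct Hs" "set Hs = lines A" "map (mult A) Hs = m"
    "\<And>i. i < length m \<Longrightarrow> hyp (unit_normal (\<phi> (int i))) = Hs ! i"
proof -
  let ?n = "length m"
  obtain Hs \<alpha> \<theta> where Hs: "distinct Hs" "set Hs = lines A" "map (mult A) Hs = m"
    and \<alpha>: "real_normals A \<alpha>" and \<theta>: "\<And>H. H \<in> lines A \<Longrightarrow> has_angle (\<alpha> H) (\<theta> H)"
    and cyc: "cyclically_ordered (map \<theta> Hs)"
    using assms(1) unfolding has_cyc_mults_def by blast
  have len: "length Hs = ?n"
    using Hs(3) by (metis length_map)
  obtain r where sorted: "sorted_wrt (<) (rotate r (map \<theta> Hs))"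
    using cyc by (auto simp: cyclically_ordered_def)
  define x where "x i = rotate r (map \<theta> Hs) ! i / 2" for i
  have x_eq: "x i = \<theta> (Hs ! ((r + i) mod ?n)) / 2" if "i < ?n" for i
    using that n len by (simp add: x_def nth_rotate)
  have x_bounds: "0 \<le> x i" "x i < pi" if "i < ?n" for i
  proof -
    have "Hs ! ((r + i) mod ?n) \<in> lines A"
      using n len Hs(2) by (metis mod_less_divisor nth_mem)
    then have "0 \<le> \<theta> (Hs ! ((r + i) mod ?n))" "\<theta> (Hs ! ((r + i) mod ?n)) < 2 * pi"
      using \<theta> by (auto simp: has_angle_def)
    then show "0 \<le> x i" "x i < pi"
      unfolding x_eq[OF that] by simp_all
  qed
  have "x i < x j" if "i < j" "j < ?n" for i j
    using sorted_wrt_nth_less[OF sorted \<open>i < j\<close>] that len by (simp add: x_def)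
  moreover have "x j < x i + pi" if "i < ?n" "j < ?n" for i j
    using x_bounds[OF that(1)] x_bounds[OF that(2)] by linarith
  ultimately have seq: "angle_seq ?n (angle_extension ?n x)"
    using n by (intro angle_seq_extension) auto
  \<comment> \<open>The shift by \<open>r\<close> undoes the rotation of the list; entries that wrap
    around change by a multiple of pi, which leaves their lines unchanged.\<close>
  define \<phi> where "\<phi> k = angle_extension ?n x (k - int r)" for k
  have "angle_extension ?n x (k - int r + int ?n) = angle_extension ?n x (k - int r) + pi" for k
    using seq by (simp add: angle_seq_def)
  then have "angle_seq ?n \<phi>"
    using seq by (auto simp: angle_seq_def \<phi>_def strict_mono_def algebra_simps)
  moreover have "hyp (unit_normal (\<phi> (int i))) = Hs ! i" if i: "i < ?n" for i
  proof -
    let ?l = "nat ((int i - int r) mod int ?n)"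
    have "int ((r + ?l) mod ?n) = (int r + (int i - int r) mod int ?n) mod int ?n"
      using n by (simp add: zmod_int)
    also have "\<dots> = int i"
      using i by (simp add: mod_add_right_eq)
    finally have "(r + ?l) mod ?n = i"
      by simp
    moreover have "?l < ?n"
      using n by (simp add: nat_less_iff)
    ultimately have "x ?l = \<theta> (Hs ! i) / 2"
      using x_eq by metis
    then have "\<phi> (int i) = \<theta> (Hs ! i) / 2 + pi * of_int ((int i - int r) div int ?n)"
      by (simp add: \<phi>_def angle_extension_def)
    then have "hyp (unit_normal (\<phi> (int i))) = hyp (unit_normal (\<theta> (Hs ! i) / 2))"
      unfolding hyp_unit_normal_eq_iff by (simp add: sin_zero_iff_int2 mult.commute)
    also have "\<dots> = Hs ! i"
    proof -
      have H: "Hs ! i \<in> lines A"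
        using i len Hs(2) by (metis nth_mem)
      then obtain c where c: "\<alpha> (Hs ! i) = c *s unit_normal (\<theta> (Hs ! i) / 2)"
        using \<theta> by (auto simp: has_angle_def unit_normal_def)
      have "Hs ! i = hyp (\<alpha> (Hs ! i))" "scalar_product (\<alpha> (Hs ! i)) (\<alpha> (Hs ! i)) \<noteq> 0"
        using \<alpha> H by (auto simp: real_normals_def normals_def)
      moreover from this(2) have "c \<noteq> 0"
        unfolding c scalar_product_scale by auto
      ultimately show ?thesis
        unfolding c by (metis hyp_scale)
    qed
    finally show ?thesis .
  qed
  ultimately show ?thesis
    using Hs that by blast
qed

section \<open>Locus configurations and equilibria\<close>

definition weight :: "nat list \<Rightarrow> int \<Rightarrow> real" where
  "weight m k = (let a = m ! nat (k mod int (length m)) in real (a * (a + 1)))"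

lemma weight_period: "weight m (k + int (length m)) = weight m k"
  by (simp add: weight_def)

lemma weight_of_nat: "i < length m \<Longrightarrow> weight m (int i) = real (m ! i * (m ! i + 1))"
  by (simp add: weight_def Let_def)

lemma weight_ge_1:
  assumes "\<forall>k\<in>set m. 0 < k" "0 < length m"
  shows "1 \<le> weight m k"
proof -
  have "nat (k mod int (length m)) < length m"
    using assms(2) by (simp add: nat_less_iff)
  then have "0 < m ! nat (k mod int (length m))"
    using assms(1) by simp
  then have "1 \<le> m ! nat (k mod int (length m)) * (m ! nat (k mod int (length m)) + 1)"
    by simp
  then show ?thesis
    unfolding weight_def Let_def by linarith
qed

text \<open>Every multiplicity is positive, so the first locus equation holds at every line; in
  terms of angles it is the balance condition.\<close>

lemma locus_configuration_equilibrium: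
  assumes "locus_configuration A" and m: "\<forall>k\<in>set m. 0 < k" "0 < length m"
    and \<phi>: "angle_seq (length m) \<phi>"
    and Hs: "distinct Hs" "set Hs = lines A" "map (mult A) Hs = m"
      "\<And>i. i < length m \<Longrightarrow> hyp (unit_normal (\<phi> (int i))) = Hs ! i"
  shows "equilibrium (length m) (weight m) \<phi>"
  unfolding equilibrium_def
proof
  fix k
  let ?n = "length m"
  define l where "l = nat (k mod int ?n)"
  let ?H = "\<lambda>i. hyp (unit_normal (\<phi> (int i)))"
  have l: "l < ?n"
    using m(2) by (simp add: l_def nat_less_iff)
  have len: "length Hs = ?n"
    using Hs(3) by (metis length_map)
  have mult: "mult A (?H j) = m ! j" if "j < ?n" for j
    using Hs(3,4) that len by (metis nth_map)
  have lines: "lines A = ?H ` {..<?n}"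
  proof -
    have "?H ` {..<?n} = (\<lambda>i. Hs ! i) ` {..<?n}"
      by (intro image_cong refl Hs(4)) simp
    also have "\<dots> = set Hs"
      using nth_image[of ?n Hs] by (simp add: len lessThan_atLeast0)
    finally show ?thesis
      using Hs(2) by simp
  qed
  have inj: "inj_on ?H {..<?n}"
  proof (rule inj_onI)
    fix a b assume ab: "a \<in> {..<?n}" "b \<in> {..<?n}" and eq: "?H a = ?H b"
    have "Hs ! a = Hs ! b"
      using eq Hs(4)[of a] Hs(4)[of b] ab by simp
    then show "a = b"
      using ab Hs(1) by (simp add: nth_eq_iff_index_eq len)
  qed
  obtain \<alpha> where \<alpha>: "normals A \<alpha>" and loc: "\<forall>H\<in>lines A. \<forall>k\<in>{1..mult A H}. locus_equation A \<alpha> H k"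
    using assms(1) by (auto simp: locus_configuration_def)
  have "0 < m ! l"
    using m(1) l by simp
  then have "locus_equation A \<alpha> (?H l) 1"
    using loc lines l mult[OF l] by auto
  then have "(\<Sum>j\<in>{..<?n} - {l}.
      real (mult A (?H j) * (mult A (?H j) + 1)) * locus_term 1 (\<phi> (int j) - \<phi> (int l))) = 0"
    using locus_equation_angles[of "\<lambda>i. \<phi> (int i)" ?n A \<alpha> l 1] inj lines \<alpha> l by simp
  also have "(\<Sum>j\<in>{..<?n} - {l}.
      real (mult A (?H j) * (mult A (?H j) + 1)) * locus_term 1 (\<phi> (int j) - \<phi> (int l)))
    = (\<Sum>j\<in>{..<?n} - {l}. weight m (int j) * locus_term 1 (\<phi> (int j) - \<phi> (int l)))"
    by (intro sum.cong refl) (simp add: mult weight_of_nat)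
  also have "\<dots> = (\<Sum>j\<in>{k<..<k + int ?n}. weight m j * locus_term 1 (\<phi> j - \<phi> k))"
    using locus_sum_period[OF m(2) \<phi>, of "weight m" 1 k] by (simp add: weight_period flip: l_def)
  finally show "(\<Sum>j\<in>{k<..<k + int ?n}. weight m j * locus_term 1 (\<phi> j - \<phi> k)) = 0" .
qed

text \<open>An equilibrium satisfies all first locus equations. Higher ones are required only at
  lines with multiplicity above 1, where coarse symmetry makes the weights symmetric and reflection
  applies.\<close>

lemma locus_configuration_exists:
  assumes m: "\<forall>k\<in>set m. 0 < k" "0 < length m" and sym: "coarsely_symmetric m"
  shows "\<exists>A. locus_configuration A \<and> real_arr A \<and> has_cyc_mults A m"
proof -
  let ?n = "length m" and ?w = "weight m"
  obtain x where x0: "x 0 = 0" and mono: "\<And>i j. i < j \<Longrightarrow> j < ?n \<Longrightarrow> x i < x j"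
    and less_pi: "\<And>i. i < ?n \<Longrightarrow> x i < pi"
    and bal: "\<And>k. k < ?n \<Longrightarrow> (\<Sum>j<?n. ?w (int j) * locus_term 1 (x j - x k)) = 0"
    using equilibrium_exists[OF m(2), of "\<lambda>i. ?w (int i)"] weight_ge_1[OF m] by blast
  have nonneg: "0 \<le> x i" if "i < ?n" for i
    using x0 mono[of 0 i] that by (cases "i = 0") auto
  define \<phi> where "\<phi> = angle_extension ?n x"
  have \<phi>_eq: "\<phi> (int i) = x i" if "i < ?n" for i
    using that by (simp add: \<phi>_def angle_extension_of_nat)
  have \<phi>: "angle_seq ?n \<phi>"
    unfolding \<phi>_def using m(2) mono less_pi nonneg
    by (intro angle_seq_extension) (auto intro: add_strict_increasing2 less_le_trans)
  have period: "(\<Sum>j\<in>{i<..<i + int ?n}. ?w j * locus_term k (\<phi> j - \<phi> i)) =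
      (\<Sum>j\<in>{..<?n} - {nat (i mod int ?n)}. ?w (int j) * locus_term k (x j - x (nat (i mod int ?n))))"
    if "1 \<le> k" for i k
  proof -
    define l where "l = nat (i mod int ?n)"
    have "l < ?n"
      using m(2) by (simp add: l_def nat_less_iff)
    then show ?thesis
      using locus_sum_period[OF m(2) \<phi>, of ?w k i] that
      by (simp add: weight_period \<phi>_eq flip: l_def)
  qed
  have "equilibrium ?n ?w \<phi>"
    unfolding equilibrium_def
  proof
    fix i
    let ?i = "nat (i mod int ?n)"
    have "?i < ?n"
      using m(2) by (simp add: nat_less_iff)
    then have "(\<Sum>j\<in>{..<?n} - {?i}. ?w (int j) * locus_term 1 (x j - x ?i)) = 0"
      using bal[of ?i] sum.remove[of "{..<?n}" ?i "\<lambda>j. ?w (int j) * locus_term 1 (x j - x ?i)"]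
      by simp
    then show "(\<Sum>j\<in>{i<..<i + int ?n}. ?w j * locus_term 1 (\<phi> j - \<phi> i)) = 0"
      using period[of 1 i] by simp
  qed
  note eq = this
  have locus: "(\<Sum>j\<in>{..<?n} - {i}. ?w (int j) * locus_term k (x j - x i)) = 0"
    if "i < ?n" "k \<in> {1..m ! i}" for i k
  proof -
    have "(\<Sum>j\<in>{int i<..<int i + int ?n}. ?w j * locus_term k (\<phi> j - \<phi> (int i))) = 0"
    proof (cases "k = 1")
      case True
      then show ?thesis
        using eq by (simp add: equilibrium_def)
    next
      case False
      then have "1 < m ! i"
        using that by auto
      then have "?w (int i + j) = ?w (int i - j)" for j
        using sym that(1) by (simp add: coarsely_symmetric_def weight_def)
      moreover have "0 < ?w j" for j
        using weight_ge_1[OF m, of j] by simp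
      ultimately show ?thesis
        using that by (intro equilibrium_symmetric_locus[OF m(2) _ weight_period \<phi> eq]) auto
    qed
    then show ?thesis
      using period[of k "int i"] that by simp
  qed
  define H where "H i = hyp (unit_normal (x i))" for i
  have inj: "inj_on H {..<?n}"
  proof (rule linorder_inj_onI')
    fix i j assume ij: "i \<in> {..<?n}" "j \<in> {..<?n}" "i < j"
    then have "0 < sin (x j - x i)"
      using mono[of i j] less_pi[of j] nonneg[of i] by (intro sin_gt_zero) auto
    then show "H i \<noteq> H j"
      unfolding H_def using hyp_unit_normal_eq_iff[of "x j" "x i"] by auto
  qed
  \<comment> \<open>Multiplicities and normals are functions of the line, so the index has to be
    recovered from it.\<close>
  define idx where "idx = the_inv_into {..<?n} H"
  have idx: "idx (H i) = i" if "i < ?n" for i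
    using inj that by (simp add: idx_def the_inv_into_f_f)
  define A where "A = \<lparr>lines = H ` {..<?n}, mult = \<lambda>K. m ! idx K\<rparr>"
  define \<alpha> where "\<alpha> K = unit_normal (x (idx K))" for K
  have lines: "lines A = H ` {..<?n}" and mult: "\<And>i. i < ?n \<Longrightarrow> mult A (H i) = m ! i"
    by (simp_all add: A_def idx)
  have \<alpha>_eq: "\<alpha> (H i) = unit_normal (x i)" if "i < ?n" for i
    using that by (simp add: \<alpha>_def idx)
  have normals: "normals A \<alpha>"
    by (auto simp: normals_def lines \<alpha>_eq scalar_product_unit_normal) (auto simp: H_def)
  have real: "real_normals A \<alpha>"
    unfolding real_normals_def using normals
    by (auto simp: lines \<alpha>_eq unit_normal_def forall_2)
  have "locus_equation A \<alpha> (H i) k" if "i < ?n" "k \<in> {1..m ! i}" for i k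
  proof -
    have "(\<Sum>j\<in>{..<?n} - {i}. real (mult A (H j) * (mult A (H j) + 1)) * locus_term k (x j - x i))
        = (\<Sum>j\<in>{..<?n} - {i}. ?w (int j) * locus_term k (x j - x i))"
      by (intro sum.cong refl) (simp add: mult weight_of_nat)
    then show ?thesis
      using locus_equation_angles[of x ?n A \<alpha> i k] inj lines normals that locus[OF that]
      by (simp add: H_def[abs_def])
  qed
  then have "locus_configuration A"
    unfolding locus_configuration_def arrangement_def
    using normals m(1) by (auto simp: lines mult intro!: exI[of _ \<alpha>])
  moreover have "real_arr A"
    using real by (auto simp: real_arr_def)
  moreover have "has_cyc_mults A m"
    unfolding has_cyc_mults_def
  proof (intro exI conjI)
    let ?Hs = "map H [0..<?n]" and ?\<theta> = "\<lambda>K. 2 * x (idx K)"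
    show "distinct ?Hs"
      using inj by (simp add: distinct_map atLeast0LessThan)
    show "set ?Hs = lines A"
      by (auto simp: lines)
    show "map (mult A) ?Hs = m"
      by (rule nth_equalityI) (simp_all add: mult)
    show "real_normals A \<alpha>"
      by (rule real)
    show "\<forall>K\<in>lines A. has_angle (\<alpha> K) (?\<theta> K)"
      using nonneg less_pi
      by (auto simp: lines idx \<alpha>_eq has_angle_def unit_normal_def intro!: exI[of _ 1])
    have "map ?\<theta> ?Hs = map (\<lambda>i. 2 * x i) [0..<?n]"
      by (simp add: idx)
    then show "cyclically_ordered (map ?\<theta> ?Hs)"
      unfolding cyclically_ordered_def using mono
      by (auto simp: sorted_wrt_iff_nth_less intro!: exI[of _ 0])
  qed
  ultimately show ?thesis
    by blast
qed

section \<open>Rotations and uniqueness of the arrangement\<close>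

definition rotation2 :: "real \<Rightarrow> real^2^2" where
  "rotation2 t = vector [vector [cos t, - sin t], vector [sin t, cos t]]"

lemma rotation_matrix_rotation2: "rotation_matrix (rotation2 t)"
proof -
  have "sin t * sin t + cos t * cos t = 1"
    by (metis sin_cos_squared_add power2_eq_square)
  then show ?thesis
    by (simp add: rotation_matrix_def orthogonal_matrix rotation2_def det_2 matrix_matrix_mult_def
        transpose_def mat_def vec_eq_iff forall_2 sum_2)
qed

text \<open>The complexified rotation sends \<open>direction a\<close> to
  \<open>direction (a + t)\<close>, and these vectors span the lines.\<close>

lemma rotation2_image_hyp:
  "(\<lambda>v. map_matrix complex_of_real (rotation2 t) *v v) ` hyp (unit_normal a)
    = hyp (unit_normal (a + t))"
proof -
  let ?R = "\<lambda>t v. map_matrix complex_of_real (rotation2 t) *v v"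
  have R: "?R t v = vector [of_real (cos t) * v $ 1 - of_real (sin t) * v $ 2,
      of_real (sin t) * v $ 1 + of_real (cos t) * v $ 2]" for t v
    by (simp add: vec_eq_iff forall_2 matrix_vector_mult_def sum_2 map_matrix_def rotation2_def)
  have dir: "?R t (c *s direction a) = c *s direction (a + t)" for c
    by (simp add: R vec_eq_iff forall_2 direction_def sin_add cos_add algebra_simps)
  show ?thesis
    unfolding hyp_unit_normal image_image dir ..
qed

theorem theorem6p4:
  fixes m :: "nat list"
  assumes "\<forall>k\<in>set m. 0 < k" and "coarsely_symmetric m"
  shows "(\<exists>A. locus_configuration A \<and> real_arr A \<and> has_cyc_mults A m) \<and>
    (\<forall>A B. locus_configuration A \<and> real_arr A \<and> has_cyc_mults A m \<and>
           locus_configuration B \<and> real_arr B \<and> has_cyc_mults B m \<longrightarrow>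
       (\<exists>Q::real^2^2. rotation_matrix Q \<and> carries Q A B))"
\<comment> \<open>The empty list is treated apart, since indices are otherwise reduced modulo its
  length.\<close>
proof (cases "m = []")
  case True
  let ?A = "\<lparr>lines = {}, mult = \<lambda>_. 0\<rparr> :: line_arr"
  have "locus_configuration ?A \<and> real_arr ?A \<and> has_cyc_mults ?A m"
    using True
    by (simp add: locus_configuration_def arrangement_def normals_def real_arr_def real_normals_def
        has_cyc_mults_def cyclically_ordered_def)
  moreover have "carries Q A B" if "has_cyc_mults A m" "has_cyc_mults B m" for A B Q
    using that True by (auto simp: has_cyc_mults_def carries_def)
  ultimately show ?thesis
    using rotation_matrix_rotation2[of 0] by blast
next
  case False
  then have m: "\<forall>k\<in>set m. 0 < k" "0 < length m"
    using assms(1) by auto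
  have "\<exists>Q. rotation_matrix Q \<and> carries Q A B"
    if loc: "locus_configuration A" "locus_configuration B"
      and cyc: "has_cyc_mults A m" "has_cyc_mults B m" for A B
  proof -
    obtain \<phi> Hs where \<phi>: "angle_seq (length m) \<phi>"
      and Hs: "distinct Hs" "set Hs = lines A" "map (mult A) Hs = m"
        "\<And>i. i < length m \<Longrightarrow> hyp (unit_normal (\<phi> (int i))) = Hs ! i"
      using has_cyc_mults_angle_seq[OF cyc(1) m(2)] by blast
    obtain \<psi> Ks where \<psi>: "angle_seq (length m) \<psi>"
      and Ks: "distinct Ks" "set Ks = lines B" "map (mult B) Ks = m"
        "\<And>i. i < length m \<Longrightarrow> hyp (unit_normal (\<psi> (int i))) = Ks ! i"
      using has_cyc_mults_angle_seq[OF cyc(2) m(2)] by blast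
    have "0 < weight m k" for k
      using weight_ge_1[OF m, of k] by simp
    \<comment> \<open>The lifts are half-angles, so translating them by \<open>t\<close> is the
      rotation by \<open>t\<close> and shifts every \<theta> by \<open>2 * t\<close>.\<close>
    then obtain t where t: "\<And>k. \<psi> k = \<phi> k + t"
      using equilibrium_unique[OF m(2) _ \<psi> locus_configuration_equilibrium[OF loc(2) m \<psi> Ks]
          \<phi> locus_configuration_equilibrium[OF loc(1) m \<phi> Hs]] by blast
    let ?f = "\<lambda>H. (\<lambda>v. map_matrix complex_of_real (rotation2 t) *v v) ` H"
    have len: "length Hs = length m" "length Ks = length m"
      using Hs(3) Ks(3) by (metis length_map)+
    have f: "?f (Hs ! i) = Ks ! i" if "i < length m" for i
      using rotation2_image_hyp[of t "\<phi> (int i)"] Hs(4)[OF that] Ks(4)[OF that] t by simp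
    have map_f: "map ?f Hs = Ks"
      by (rule nth_equalityI) (simp_all add: len f)
    have "mult B (?f H) = mult A H" if H: "H \<in> lines A" for H
    proof -
      obtain i where i: "i < length m" "H = Hs ! i"
        using H Hs(2) len(1) by (metis in_set_conv_nth)
      have "mult B (Ks ! i) = map (mult B) Ks ! i" "mult A (Hs ! i) = map (mult A) Hs ! i"
        using i len by simp_all
      then show ?thesis
        unfolding i(2) f[OF i(1)] Hs(3) Ks(3) by simp
    qed
    moreover have "lines B = ?f ` lines A"
      using map_f Hs(2) Ks(2) by (metis set_map)
    ultimately have "carries (rotation2 t) A B"
      unfolding carries_def Let_def by blast
    then show ?thesis
      using rotation_matrix_rotation2 by blast
  qed
  then show ?thesis
    using locus_configuration_exists[OF m assms(2)] by blast
qed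

end
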